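(* For every integer $s\ge 1$, the following identities of formal power series in $y$ hold: $$\Phi_s(y)=\frac{P_{s+2}(-y)}{Q_{s+2}(-y)},\qquad \Psi_s(y)=\frac{1-Q_{s+2}(-y)}{y\,Q_{s+2}(-y)}.$$ Moreover, the full dimension generating function $F_s(x):=\sum_{d\ge2}N_d(s)\,x^d$ satisfies $$F_s(x)=x\bigl(\Phi_s(x^2)-(s+2)\bigr)+x^2\,\Psi_s(x^2).$$
   Context: For integers $d\ge2$ and $s\ge1$ let $$\mathcal P_d^{(s)}=\{x=(x_1,\dots,x_d)\in\mathbb R_{\ge0}^d:\ x_i+x_{i+1}\le s+\delta_i,\ 1\le i\le d-1\},$$ where $\delta_i=0$ for $i$ odd and $\delta_i=1$ for $i$ even. Let $N_d(s):=\#(\mathcal P_d^{(s)}\cap\mathbb Z^d)$. Define the formal power series $$\Phi_s(y):=(s+2)+\sum_{m\ge1}N_{2m+1}(s)\,y^m,\qquad \Psi_s(y):=\sum_{m\ge0}N_{2m+2}(s)\,y^m$$ (the constant term $s+2$ of $\Phi_s$ is an auxiliary normalization). Define the polynomials $$P_n(y):=\sum_{k=0}^{\lfloor (n-1)/2\rfloor}\binom{n}{2k+1}y^k,\qquad Q_n(y):=\sum_{k=0}^{\lfloor n/2\rfloor}\binom{n}{2k}y^k.$$ *)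

theory Defs
  imports Complex_Main "HOL-Library.FuncSet" "HOL-Computational_Algebra.Polynomial_FPS"
begin

definition delta :: "nat \<Rightarrow> nat" where
  "delta i = (if odd i then 0 else 1)"

text \<open>As the dimension d is a bound index of the generating functions, points of d-dimensional
  space are functions on {1..d} that are undefined outside {1..d}.\<close>

definition polytope_P :: "nat \<Rightarrow> nat \<Rightarrow> (nat \<Rightarrow> real) set" where
  "polytope_P d s = {x \<in> {1..d} \<rightarrow>\<^sub>E {0..}. \<forall>i\<in>{1..d-1}. x i + x (i+1) \<le> real (s + delta i)}"

definition num_points :: "nat \<Rightarrow> nat \<Rightarrow> nat" where
  "num_points d s = card (polytope_P d s \<inter> ({1..d} \<rightarrow>\<^sub>E \<int>))"

lemma finite_lattice_points:
  assumes "d \<ge> 2"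
  shows "finite (polytope_P d s \<inter> ({1..d} \<rightarrow>\<^sub>E \<int>))"
proof -
  have "x i \<le> real (s + 1)"
    if x: "x \<in> polytope_P d s" and i: "i \<in> {1..d}" for x i
  proof -
    define j where "j = (if i < d then i else i - 1)"
    have j: "j \<in> {1..d-1}" and ij: "i = j \<or> i = j + 1"
      using i assms by (auto simp: j_def)
    have "j \<in> {1..d}" "j + 1 \<in> {1..d}" using j assms by auto
    then have "x j \<ge> 0" "x (j+1) \<ge> 0"
      using x unfolding polytope_P_def PiE_iff by blast+
    moreover have "x j + x (j+1) \<le> real (s + delta j)"
      using x j unfolding polytope_P_def by blast
    moreover have "real (s + delta j) \<le> real (s + 1)"
      by (simp add: delta_def)
    ultimately show ?thesis using ij by auto
  qed
  moreover have "x i \<ge> 0" if "x \<in> polytope_P d s" "i \<in> {1..d}" for x i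
    using that by (auto simp: polytope_P_def PiE_iff)
  ultimately have "polytope_P d s \<inter> ({1..d} \<rightarrow>\<^sub>E \<int>)
      \<subseteq> {1..d} \<rightarrow>\<^sub>E {r \<in> \<int>. \<bar>r\<bar> \<le> real (s + 1)}"
    by (auto simp: PiE_iff)
  moreover have "finite ({1..d} \<rightarrow>\<^sub>E {r \<in> \<int>. \<bar>r\<bar> \<le> real (s + 1)})"
    by (intro finite_PiE finite_abs_int_segment) auto
  ultimately show ?thesis
    by (rule finite_subset)
qed

definition Phi :: "nat \<Rightarrow> rat fps" where
  "Phi s = Abs_fps (\<lambda>m. if m = 0 then of_nat (s + 2) else of_nat (num_points (2*m+1) s))"

definition Psi :: "nat \<Rightarrow> rat fps" where
  "Psi s = Abs_fps (\<lambda>m. of_nat (num_points (2*m+2) s))"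

definition F_gen :: "nat \<Rightarrow> rat fps" where
  "F_gen s = Abs_fps (\<lambda>d. if d \<ge> 2 then of_nat (num_points d s) else 0)"

text \<open>For n = 0 the truncated upper bound gives the single summand 0 choose 1 = 0,
  that is, the empty sum.\<close>

definition P_poly :: "nat \<Rightarrow> rat poly" where
  "P_poly n = (\<Sum>k=0..(n-1) div 2. monom (of_nat (n choose (2*k+1))) k)"

definition Q_poly :: "nat \<Rightarrow> rat poly" where
  "Q_poly n = (\<Sum>k=0..n div 2. monom (of_nat (n choose (2*k))) k)"

definition P_neg :: "nat \<Rightarrow> rat fps" where
  "P_neg n = fps_of_poly (P_poly n) oo (- fps_X)"

definition Q_neg :: "nat \<Rightarrow> rat fps" where
  "Q_neg n = fps_of_poly (Q_poly n) oo (- fps_X)"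

text \<open>Division of formal power series over a field discards negative powers. The next two facts
  show that nothing is discarded in the quotients by Q(-y) and by y Q(-y): both are exact.\<close>

lemma Q_neg_nth_0: "fps_nth (Q_neg n) 0 = 1"
proof -
  have "coeff (Q_poly n) 0 = (\<Sum>k=0..n div 2. if k = 0 then 1 else 0)"
    unfolding Q_poly_def coeff_sum by (intro sum.cong) auto
  then show ?thesis by (simp add: Q_neg_def)
qed

lemma fps_X_Q_neg_dvd: "fps_X * Q_neg n dvd 1 - Q_neg n"
proof -
  have "is_unit (Q_neg n)" by (simp add: Q_neg_nth_0)
  moreover have "1 - Q_neg n = fps_X * fps_shift 1 (1 - Q_neg n)"
    by (rule fps_ext) (simp add: Q_neg_nth_0)
  ultimately show ?thesis by (metis dvd_triv_left mult_unit_dvd_iff)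
qed

end

theory Submission
  imports Defs "HOL-Computational_Algebra.Formal_Laurent_Series"
begin

text \<open>
  The number of lattice points is computed one coordinate at a time. Let \<open>c d j\<close> count the lattice
  points of the \<open>d\<close>-dimensional polytope whose last coordinate is below \<open>j\<close>. If the new coordinate
  \<open>x (d + 1)\<close> equals \<open>j\<close>, then the last constraint says exactly that
  \<open>x d < s + 1 + delta d - j\<close>, so
  \<open>c (d + 1) (j + 1) = c (d + 1) j + c d (s + 1 + delta d - j)\<close>, with \<open>c 1 j = j\<close>
  (lemmas \<open>card_points_below_Suc_Suc\<close> and \<open>card_points_below_1\<close>).

  Put \<open>n = s + 2\<close>, and sum over all odd and over all even dimensions:
  \<open>E j = (\<Sum>m. c (2m + 1) j y^m)\<close> and \<open>G j = (\<Sum>m. c (2m + 2) j y^m)\<close>.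
  The alternating shift \<open>delta\<close> makes the two recurrences mirror images of each other: with
  \<open>H j = 1 + y G (n - j)\<close> they become the linear system with constant coefficients
  \<open>E (j + 1) = E j + H j\<close>, \<open>H (j + 1) = H j - y E j\<close>, where \<open>E 0 = 0\<close>.
  Its matrix has eigenvalues \<open>1 \<plusminus> sqrt (-y)\<close>, and \<open>Q_j(-y)\<close> and \<open>P_j(-y)\<close> are the coefficients in
  \<open>(1 + sqrt (-y))^j = Q_j(-y) + sqrt (-y) P_j(-y)\<close>; they satisfy the same system by Pascal's
  rule. Hence \<open>E j = H 0 P_j(-y)\<close> and \<open>H j = H 0 Q_j(-y)\<close> (lemma \<open>gf_eq_multiple\<close>). The other
  end of the system supplies the missing boundary value: \<open>G 0 = 0\<close> means \<open>H n = 1\<close>, so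
  \<open>H 0 = 1 / Q_n(-y)\<close>.

  From dimension 2 on, no last coordinate exceeds \<open>s + 1\<close>, so \<open>\<Psi> = G n\<close>, and also \<open>\<Phi> = E n\<close>: its constant
  term \<open>s + 2\<close> is \<open>c 1 (s + 2)\<close>, the number of integers in the interval from \<open>0\<close> to \<open>s + 1\<close>.
  Both quotients follow. The formula for the full generating function only separates the even
  from the odd dimensions.
\<close>

section \<open>Counting lattice points by their last coordinate\<close>

text \<open>The bound \<open>j\<close> is the variable of the recurrence. It also makes dimension 1, where the polytope
  is an unbounded half-line, a finite start of the recurrence over the dimension.\<close>
definition points_below :: "nat \<Rightarrow> nat \<Rightarrow> nat \<Rightarrow> (nat \<Rightarrow> real) set" where
  "points_below s d j = {x \<in> polytope_P d s \<inter> ({1..d} \<rightarrow>\<^sub>E \<int>). x d < real j}"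

lemma Ints_less_Suc:
  assumes "(r::real) \<in> \<int>" "r < real (Suc j)"
  shows "r < real j \<or> r = real j"
proof -
  obtain k where k: "r = of_int k" using assms(1) by (elim Ints_cases)
  have "k < int j + 1" using assms(2) k by linarith
  then consider "k < int j" | "k = int j" by linarith
  then show ?thesis by cases (simp_all add: k)
qed

lemma points_below_mono: "j \<le> k \<Longrightarrow> points_below s d j \<subseteq> points_below s d k"
proof
  fix x assume "j \<le> k" "x \<in> points_below s d j"
  then show "x \<in> points_below s d k"
    by (simp add: points_below_def)
qed

lemma points_below_0: "d \<ge> 1 \<Longrightarrow> points_below s d 0 = {}"
  by (force simp: points_below_def polytope_P_def PiE_iff)

lemma points_below_1_Suc:
  "points_below s 1 (Suc j) = insert (\<lambda>i\<in>{1}. real j) (points_below s 1 j)"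
proof -
  have "points_below s 1 (Suc j) \<subseteq> insert (\<lambda>i\<in>{1}. real j) (points_below s 1 j)"
  proof
    fix x assume x: "x \<in> points_below s 1 (Suc j)"
    show "x \<in> insert (\<lambda>i\<in>{1}. real j) (points_below s 1 j)"
    proof (cases "x 1 < real j")
      case True
      then show ?thesis using x by (simp add: points_below_def)
    next
      case False
      then have "x 1 = real j" "x \<in> extensional {1}"
        using x Ints_less_Suc[of "x 1" j] by (auto simp: points_below_def PiE_iff)
      then have "x = (\<lambda>i\<in>{1}. real j)" by (intro extensionalityI[of _ "{1}"]) auto
      then show ?thesis by blast
    qed
  qed
  moreover have "(\<lambda>i\<in>{1}. real j) \<in> points_below s 1 (Suc j)"
    by (simp add: points_below_def polytope_P_def restrict_PiE_iff)
  moreover have "points_below s 1 j \<subseteq> points_below s 1 (Suc j)"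
    by (rule points_below_mono) simp
  ultimately show ?thesis by (metis insert_subset subset_antisym)
qed

lemma card_points_below_1: "finite (points_below s 1 j) \<and> card (points_below s 1 j) = j"
proof (induction j)
  case 0
  then show ?case by (simp add: points_below_0)
next
  case (Suc j)
  have "(\<lambda>i\<in>{1}. real j) \<notin> points_below s 1 j" by (simp add: points_below_def)
  then show ?case using Suc by (simp add: points_below_1_Suc del: One_nat_def)
qed

text \<open>The bound \<open>s + 1 + delta d - j\<close> on \<open>y d\<close> is the constraint between the coordinates \<open>d\<close> and
  \<open>d + 1\<close>, made strict; this turns the coupling of two coordinates into a condition on the shorter
  point alone.\<close>
lemma append_in_points_below:
  assumes "d \<ge> 1" "y \<in> points_below s d (s + 1 + delta d - j)"
  shows "y(Suc d := real j) \<in> points_below s (Suc d) (Suc j)"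
proof -
  have yd: "y d < real (s + 1 + delta d - j)" and y: "y \<in> polytope_P d s" "y \<in> {1..d} \<rightarrow>\<^sub>E \<int>"
    using assms(2) by (auto simp: points_below_def)
  have "y d \<in> \<int>" "y d \<ge> 0" using y assms(1) by (auto simp: PiE_iff polytope_P_def)
  then obtain k where k: "y d = real k" by (metis Nats_cases Nats_altdef2 mem_Collect_eq)
  \<comment> \<open>If the subtraction were truncated, then \<open>y d < 0\<close>, which is impossible.\<close>
  then have "k < s + 1 + delta d - j" using yd by linarith
  then have "k + j \<le> s + delta d" by linarith
  then have kj: "y d + real j \<le> real (s + delta d)" unfolding k by linarith
  have "(y(Suc d := real j)) i + (y(Suc d := real j)) (i + 1) \<le> real (s + delta i)"
    if "i \<in> {1..Suc d - 1}" for i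
  proof (cases "i = d")
    case True
    then show ?thesis using kj by simp
  next
    case False
    then have "i \<in> {1..d-1}" using that by auto
    then show ?thesis using y(1) by (auto simp: polytope_P_def)
  qed
  moreover have "y(Suc d := real j) \<in> {1..Suc d} \<rightarrow>\<^sub>E {0..}"
    using y(1) by (auto simp: polytope_P_def PiE_iff extensional_def)
  moreover have "y(Suc d := real j) \<in> {1..Suc d} \<rightarrow>\<^sub>E \<int>"
    using y(2) by (auto simp: PiE_iff extensional_def)
  ultimately show ?thesis by (simp add: points_below_def polytope_P_def)
qed

lemma drop_last_in_points_below:
  assumes "d \<ge> 1" "x \<in> points_below s (Suc d) (Suc j)" "x (Suc d) = real j"
  shows "x(Suc d := undefined) \<in> points_below s d (s + 1 + delta d - j)"
proof -
  have x: "x \<in> polytope_P (Suc d) s" "x \<in> {1..Suc d} \<rightarrow>\<^sub>E \<int>"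
    using assms(2) by (auto simp: points_below_def)
  have con: "x i + x (i + 1) \<le> real (s + delta i)" if "i \<in> {1..d}" for i
    using x(1) that by (auto simp: polytope_P_def)
  have "x d + real j \<le> real (s + delta d)" "x d \<ge> 0"
    using con[of d] x(1) assms by (auto simp: polytope_P_def PiE_iff)
  then have "x d < real (s + 1 + delta d - j)" by linarith
  moreover have "x(Suc d := undefined) \<in> {1..d} \<rightarrow>\<^sub>E {0..}"
    using x(1) by (auto simp: polytope_P_def PiE_iff extensional_def)
  moreover have "x(Suc d := undefined) \<in> {1..d} \<rightarrow>\<^sub>E \<int>"
    using x(2) by (auto simp: PiE_iff extensional_def)
  ultimately show ?thesis using con by (auto simp: points_below_def polytope_P_def)
qed

lemma points_below_Suc_Suc:
  assumes "d \<ge> 1"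
  shows "points_below s (Suc d) (Suc j) =
    points_below s (Suc d) j \<union> (\<lambda>y. y(Suc d := real j)) ` points_below s d (s + 1 + delta d - j)"
proof -
  have "x \<in> (\<lambda>y. y(Suc d := real j)) ` points_below s d (s + 1 + delta d - j)"
    if x: "x \<in> points_below s (Suc d) (Suc j)" "x \<notin> points_below s (Suc d) j" for x
  proof -
    have "x (Suc d) = real j"
      using x Ints_less_Suc[of "x (Suc d)" j] by (auto simp: points_below_def PiE_iff)
    then show ?thesis
      using drop_last_in_points_below[OF assms x(1)]
      by (intro image_eqI[of _ _ "x(Suc d := undefined)"]) auto
  qed
  moreover have "points_below s (Suc d) j \<subseteq> points_below s (Suc d) (Suc j)"
    by (rule points_below_mono) simp
  ultimately show ?thesis
    using append_in_points_below[OF assms] by blast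
qed

lemma inj_on_append:
  assumes "d \<ge> 1"
  shows "inj_on (\<lambda>y. y(Suc d := real j)) (points_below s d k)"
proof (rule inj_onI)
  fix y z assume *: "y \<in> points_below s d k" "z \<in> points_below s d k"
    "y(Suc d := real j) = z(Suc d := real j)"
  then have "y \<in> extensional {1..d}" "z \<in> extensional {1..d}"
    by (auto simp: points_below_def PiE_iff)
  moreover have "y i = z i" if "i \<in> {1..d}" for i
    using fun_cong[OF *(3), of i] that by (simp split: if_splits)
  ultimately show "y = z" by (rule extensionalityI)
qed

text \<open>The cardinality recurrence below needs finiteness, which follows from the same decomposition
  by a nested induction on the dimension and on the bound.\<close>
lemma finite_points_below: "d \<ge> 1 \<Longrightarrow> finite (points_below s d j)"
proof (induction d arbitrary: j rule: nat_induct_at_least)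
  case base
  then show ?case using card_points_below_1 by blast
next
  case (Suc d)
  show ?case
  proof (induction j)
    case 0
    then show ?case by (simp add: points_below_0)
  next
    case (Suc j)
    then show ?case using points_below_Suc_Suc[OF \<open>d \<ge> 1\<close>] Suc.IH \<open>\<And>j. finite (points_below s d j)\<close>
      by simp
  qed
qed

lemma card_points_below_Suc_Suc:
  assumes "d \<ge> 1"
  shows "card (points_below s (Suc d) (Suc j)) =
    card (points_below s (Suc d) j) + card (points_below s d (s + 1 + delta d - j))"
proof -
  have "points_below s (Suc d) j \<inter>
      (\<lambda>y. y(Suc d := real j)) ` points_below s d (s + 1 + delta d - j) = {}"
    by (auto simp: points_below_def)
  then show ?thesis
    using assms by (simp add: points_below_Suc_Suc card_Un_disjoint finite_points_below
        card_image[OF inj_on_append])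
qed

text \<open>Every coordinate with a left neighbour is at most \<open>s + 1\<close>, so from dimension 2 on the bound
  \<open>s + 2\<close> is vacuous.\<close>
lemma num_points_eq_card_points_below:
  assumes "d \<ge> 2"
  shows "num_points d s = card (points_below s d (s + 2))"
proof -
  have "x d < real (s + 2)" if "x \<in> polytope_P d s" for x
  proof -
    have "d - 1 \<in> {1..d}" "d - 1 \<in> {1..d-1}" "d - 1 + 1 = d" using assms by auto
    then have "x (d - 1) \<ge> 0" "x (d - 1) + x d \<le> real (s + delta (d - 1))"
      using that unfolding polytope_P_def PiE_iff by (blast, metis (mono_tags, lifting) mem_Collect_eq)
    moreover have "delta (d - 1) \<le> 1" by (simp add: delta_def)
    ultimately show ?thesis by linarith
  qed
  then have "polytope_P d s \<inter> ({1..d} \<rightarrow>\<^sub>E \<int>) = points_below s d (s + 2)"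
    by (auto simp: points_below_def)
  then show ?thesis by (simp add: num_points_def)
qed

section \<open>Pascal recurrences for the two polynomials\<close>

lemma P_neg_nth: "fps_nth (P_neg n) k = (-1) ^ k * of_nat (n choose (2 * k + 1))"
proof -
  have "coeff (P_poly n) k = (\<Sum>i=0..(n-1) div 2. if i = k then of_nat (n choose (2 * k + 1)) else 0)"
    unfolding P_poly_def coeff_sum by (intro sum.cong) auto
  then have "coeff (P_poly n) k = of_nat (n choose (2 * k + 1))"
    by (auto simp: binomial_eq_0)
  then show ?thesis
    by (simp add: P_neg_def fps_compose_uminus')
qed

lemma Q_neg_nth: "fps_nth (Q_neg n) k = (-1) ^ k * of_nat (n choose (2 * k))"
proof -
  have "coeff (Q_poly n) k = (\<Sum>i=0..n div 2. if i = k then of_nat (n choose (2 * k)) else 0)"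
    unfolding Q_poly_def coeff_sum by (intro sum.cong) auto
  then have "coeff (Q_poly n) k = of_nat (n choose (2 * k))"
    by (auto simp: binomial_eq_0)
  then show ?thesis
    by (simp add: Q_neg_def fps_compose_uminus')
qed

lemma P_neg_0: "P_neg 0 = 0"
  by (rule fps_ext) (simp add: P_neg_nth)

lemma Q_neg_0: "Q_neg 0 = 1"
  by (rule fps_ext) (simp add: Q_neg_nth)

lemma P_neg_Suc: "P_neg (Suc n) = P_neg n + Q_neg n"
  by (rule fps_ext) (simp add: P_neg_nth Q_neg_nth algebra_simps)

lemma Q_neg_Suc: "Q_neg (Suc n) = Q_neg n - fps_X * P_neg n"
proof (rule fps_ext)
  fix k show "fps_nth (Q_neg (Suc n)) k = fps_nth (Q_neg n - fps_X * P_neg n) k"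
    by (cases k) (simp_all add: P_neg_nth Q_neg_nth algebra_simps)
qed

section \<open>Generating functions over odd and even dimensions\<close>

definition odd_gf :: "nat \<Rightarrow> nat \<Rightarrow> rat fps" where
  "odd_gf s j = Abs_fps (\<lambda>m. of_nat (card (points_below s (2 * m + 1) j)))"

definition even_gf :: "nat \<Rightarrow> nat \<Rightarrow> rat fps" where
  "even_gf s j = Abs_fps (\<lambda>m. of_nat (card (points_below s (2 * m + 2) j)))"

lemma odd_gf_0: "odd_gf s 0 = 0"
  by (rule fps_ext) (simp add: odd_gf_def points_below_0)

lemma even_gf_0: "even_gf s 0 = 0"
  by (rule fps_ext) (simp add: even_gf_def points_below_0)

text \<open>The summand 1 comes from dimension 1, where raising the bound by one adds a single point. In
  higher odd dimensions the last constraint has an even index, whence the bound \<open>s + 2 - j\<close>.\<close>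
lemma odd_gf_Suc: "odd_gf s (Suc j) = odd_gf s j + (1 + fps_X * even_gf s (s + 2 - j))"
proof (rule fps_ext)
  fix m show "fps_nth (odd_gf s (Suc j)) m
      = fps_nth (odd_gf s j + (1 + fps_X * even_gf s (s + 2 - j))) m"
  proof (cases m)
    case 0
    then show ?thesis using card_points_below_1 by (simp add: odd_gf_def)
  next
    case (Suc k)
    then show ?thesis using card_points_below_Suc_Suc[of "2 * k + 2" s j]
      by (simp add: odd_gf_def even_gf_def delta_def)
  qed
qed

lemma even_gf_Suc: "even_gf s (Suc j) = even_gf s j + odd_gf s (s + 1 - j)"
proof (rule fps_ext)
  fix m show "fps_nth (even_gf s (Suc j)) m = fps_nth (even_gf s j + odd_gf s (s + 1 - j)) m"
    using card_points_below_Suc_Suc[of "2 * m + 1" s j]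
    by (simp add: odd_gf_def even_gf_def delta_def)
qed

text \<open>Reading the even recurrence backwards, from \<open>s + 2 - j\<close> down to \<open>s + 2 - (j + 1)\<close>, makes its
  increment \<open>odd_gf s j\<close>. The pair on the left then obeys the recurrences of \<open>P_neg\<close> and \<open>Q_neg\<close>, and
  only its value at \<open>j = 0\<close>, the factor \<open>H s\<close>, distinguishes the two pairs. This factor is unknown
  until the case \<open>j = s + 2\<close> determines it.\<close>
lemma gf_eq_multiple:
  defines "H \<equiv> \<lambda>s. 1 + fps_X * even_gf s (s + 2)"
  assumes "j \<le> s + 2"
  shows "odd_gf s j = H s * P_neg j \<and> 1 + fps_X * even_gf s (s + 2 - j) = H s * Q_neg j"
  using assms(2)
proof (induction j)
  case 0
  then show ?case by (simp add: odd_gf_0 P_neg_0 Q_neg_0 H_def)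
next
  case (Suc j)
  then have IH: "odd_gf s j = H s * P_neg j" "1 + fps_X * even_gf s (s + 2 - j) = H s * Q_neg j"
    by auto
  have "even_gf s (s + 2 - j) = even_gf s (s + 2 - Suc j) + odd_gf s j"
    using even_gf_Suc[of s "s + 2 - Suc j"] Suc.prems by (simp add: Suc_diff_le)
  then have "1 + fps_X * even_gf s (s + 2 - Suc j)
      = (1 + fps_X * even_gf s (s + 2 - j)) - fps_X * odd_gf s j"
    by (simp add: algebra_simps)
  then show ?case using IH by (simp add: odd_gf_Suc P_neg_Suc Q_neg_Suc algebra_simps)
qed

section \<open>The closed forms\<close>

lemma Phi_eq_odd_gf: "Phi s = odd_gf s (s + 2)"
proof (rule fps_ext)
  fix m show "fps_nth (Phi s) m = fps_nth (odd_gf s (s + 2)) m"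
    using card_points_below_1[of s "s + 2"]
    by (cases m) (simp_all add: Phi_def odd_gf_def num_points_eq_card_points_below)
qed

lemma Psi_eq_even_gf: "Psi s = even_gf s (s + 2)"
  by (rule fps_ext) (simp add: Psi_def even_gf_def num_points_eq_card_points_below)

lemma F_gen_eq:
  "F_gen s = fps_X * ((Phi s oo fps_X^2) - of_nat (s+2)) + fps_X^2 * (Psi s oo fps_X^2)"
proof (rule fps_ext)
  fix d :: nat
  consider "d = 0" | m where "d = 2 * m + 1" | m where "d = 2 * m + 2"
    by (metis Suc_1 Suc_eq_plus1 add_Suc_right evenE mult_Suc_right not0_implies_Suc oddE add.commute
        mult_0_right)
  then show "fps_nth (F_gen s) d =
      fps_nth (fps_X * ((Phi s oo fps_X^2) - of_nat (s+2)) + fps_X^2 * (Psi s oo fps_X^2)) d"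
  proof cases
    case 1
    then show ?thesis by (simp add: F_gen_def)
  next
    case (2 m)
    then show ?thesis
      by (cases "m = 0") (auto simp: F_gen_def Phi_def fps_X_power_mult_nth fps_nth_compose_X_power
          fps_nth_of_nat fps_numeral_nth)
  next
    case (3 m)
    then show ?thesis
      by (simp add: F_gen_def Psi_def fps_X_power_mult_nth fps_nth_compose_X_power fps_nth_of_nat
          fps_numeral_nth)
  qed
qed

theorem theorem1p1:
  fixes s :: nat
  assumes "s \<ge> 1"
  shows "Phi s = P_neg (s+2) / Q_neg (s+2)
       \<and> Psi s = (1 - Q_neg (s+2)) / (fps_X * Q_neg (s+2))
       \<and> F_gen s = fps_X * ((Phi s oo fps_X^2) - of_nat (s+2)) + fps_X^2 * (Psi s oo fps_X^2)"
proof -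
  define H where "H = 1 + fps_X * Psi s"
  \<comment> \<open>The second equation is the boundary condition \<open>even_gf s 0 = 0\<close>; it identifies \<open>H\<close> as the
    inverse of \<open>Q_neg (s + 2)\<close>.\<close>
  have Phi: "Phi s = H * P_neg (s + 2)" and HQ: "H * Q_neg (s + 2) = 1"
    using gf_eq_multiple[of "s + 2" s] even_gf_0[of s]
    by (simp_all add: H_def Phi_eq_odd_gf Psi_eq_even_gf)
  have Q: "Q_neg (s + 2) \<noteq> 0" using Q_neg_nth_0[of "s + 2"] by auto
  have "P_neg (s + 2) = Phi s * Q_neg (s + 2)"
    using HQ by (simp add: Phi mult.assoc mult.commute[of "P_neg _"] flip: mult.assoc)
  then have "Phi s = P_neg (s + 2) / Q_neg (s + 2)" using Q by simp
  moreover have "1 - Q_neg (s + 2) = Psi s * (fps_X * Q_neg (s + 2))"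
    using HQ by (simp add: H_def algebra_simps)
  then have "Psi s = (1 - Q_neg (s + 2)) / (fps_X * Q_neg (s + 2))" using Q by simp
  ultimately show ?thesis using F_gen_eq by blast
qed

end
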